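(* There exist absolute constants $\varepsilon_0>0$ and $c>0$ such that any $\varepsilon_0$-tester (possibly adaptive) for monotonicity of distributions over $[n]$ in the ${\sf EVAL}$ model must perform $c\frac{\log n}{\log\log n}$ queries (in the worst case). Furthermore, one can take $\varepsilon_0=1/2$.
   Context: A distribution over $[n]$ is monotone if $D(1)\ge\dots\ge D(n)$; $\mathcal{M}$ is the class of such distributions; $d_{TV}(D_1,D_2)=\frac12\sum_x|D_1(x)-D_2(x)|$, $d_{TV}(D,\mathcal{M})=\inf_{D'\in\mathcal{M}}d_{TV}(D,D')$. An ${\sf EVAL}$ oracle for $D$ takes $x\in[n]$ and returns $D(x)$. An $\varepsilon$-tester for monotonicity is a randomized algorithm that, with oracle access to $D$, outputs ACCEPT with probability at least $2/3$ if $D\in\mathcal{M}$ and REJECT with probability at least $2/3$ if $d_{TV}(D,\mathcal{M})\ge\varepsilon$. *)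

theory Defs
  imports "HOL-Probability.Probability"
begin

definition dists :: "nat \<Rightarrow> nat pmf set" where
  "dists n = {D. set_pmf D \<subseteq> {1..n}}"

definition monotone_dists :: "nat \<Rightarrow> nat pmf set" where
  "monotone_dists n = {D \<in> dists n. \<forall>i\<in>{1..n}. \<forall>j\<in>{1..n}. i \<le> j \<longrightarrow> pmf D j \<le> pmf D i}"

definition d_TV :: "nat \<Rightarrow> nat pmf \<Rightarrow> nat pmf \<Rightarrow> real" where
  "d_TV n D1 D2 = (\<Sum>x\<in>{1..n}. \<bar>pmf D1 x - pmf D2 x\<bar>) / 2"

definition dist_to_monotone :: "nat \<Rightarrow> nat pmf \<Rightarrow> real" where
  "dist_to_monotone n D = (INF D'\<in>monotone_dists n. d_TV n D D')"

datatype verdict = ACCEPT | REJECT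

text \<open>
  A deterministic adaptive algorithm is a decision tree: a query point together with a
  continuation that depends on the (real) answer of the oracle. The trees are well-founded, so
  every run halts, but the number of queries need not be bounded. The set function \<open>queried\<close>
  collects all points occurring at some node of the tree.
\<close>

datatype (queried: 'x) algorithm =
  Output verdict
| Query 'x "real \<Rightarrow> 'x algorithm"

primrec run :: "'x algorithm \<Rightarrow> ('x \<Rightarrow> real) \<Rightarrow> verdict" where
  "run (Output v) f = v"
| "run (Query x k) f = run (k (f x)) f"

primrec num_queries :: "'x algorithm \<Rightarrow> ('x \<Rightarrow> real) \<Rightarrow> nat" where
  "num_queries (Output v) f = 0"
| "num_queries (Query x k) f = Suc (num_queries (k (f x)) f)"

text \<open>
  A randomized algorithm is a probability measure \<open>P\<close> on deterministic algorithms, with an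
  arbitrary sigma-algebra that makes the acceptance events measurable. This covers any source of
  randomness, by pushing it forward along the map from random outcomes to decision trees. Fixing
  the sample type in this way, rather than leaving it as a type variable, keeps the constants of
  a lower bound independent of the source of randomness. The \<open>EVAL\<close> oracle for \<open>D\<close> is \<open>pmf D\<close>.
\<close>

definition randomized_algorithm :: "nat \<Rightarrow> nat algorithm measure \<Rightarrow> bool" where
  "randomized_algorithm n P \<longleftrightarrow>
     prob_space P \<and>
     (\<forall>T\<in>space P. queried T \<subseteq> {1..n}) \<and>
     (\<forall>D\<in>dists n. {T \<in> space P. run T (pmf D) = ACCEPT} \<in> sets P)"

definition monotonicity_tester :: "nat \<Rightarrow> real \<Rightarrow> nat algorithm measure \<Rightarrow> bool" where
  "monotonicity_tester n \<epsilon> P \<longleftrightarrow>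
     randomized_algorithm n P \<and>
     (\<forall>D\<in>monotone_dists n.
        measure P {T \<in> space P. run T (pmf D) = ACCEPT} \<ge> 2 / 3) \<and>
     (\<forall>D\<in>dists n. dist_to_monotone n D \<ge> \<epsilon> \<longrightarrow>
        measure P {T \<in> space P. run T (pmf D) = REJECT} \<ge> 2 / 3)"

text \<open>
  The worst case is over the input distribution and the random choices of the algorithm: the
  supremum of the numbers of queries is at least \<open>r\<close> iff some run makes at least \<open>r\<close> queries,
  also when this supremum is infinite.
\<close>

definition worst_case_queries_at_least :: "nat \<Rightarrow> nat algorithm measure \<Rightarrow> real \<Rightarrow> bool" where
  "worst_case_queries_at_least n P r \<longleftrightarrow>
     (\<exists>T\<in>space P. \<exists>D\<in>dists n. real (num_queries T (pmf D)) \<ge> r)"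

end

theory Submission imports Defs
begin

text \<open>
  Split an initial part of \<open>{1..n}\<close> into \<open>k\<close> consecutive blocks, the \<open>i\<close>-th of size \<open>(4 k)^(i+1)\<close>;
  they fit into \<open>{1..n}\<close> for some \<open>k\<close> of order \<open>log n / log log n\<close>. Let \<open>U\<close> pick a uniform block and
  then a uniform point in it. For each \<open>j\<close>, mixing \<open>U / 4\<close> with \<open>3 / 4\<close> of the uniform distribution on
  block \<open>j\<close> gives a monotone distribution, because the growth of the blocks compensates the extra
  weight; mixing it with \<open>3 / 4\<close> of the point mass at the right end of block \<open>j\<close> gives a distribution
  that is \<open>1 / 2\<close>-far from monotone. Outside block \<open>j\<close> both equal \<open>U / 4\<close>, which does not depend on
  \<open>j\<close>, so a decision tree with \<open>q\<close> queries separates the two for at most \<open>q\<close> values of \<open>j\<close>, while a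
  tester separates them with probability at least \<open>1 / 3\<close> for each \<open>j\<close>. Hence \<open>q \<ge> k / 3\<close>.
\<close>

section \<open>Decision trees and counting queries\<close>

text \<open>\<open>S\<close> consists of the points asked on the path of \<open>f\<close>, cut off
  after \<open>r\<close> queries. Agreement on \<open>S\<close> keeps \<open>g\<close> on that path,
  until it halts with the same verdict or asks more than \<open>r\<close> times. The cutoff keeps
  \<open>S\<close> small without a bound on the depth of the tree.\<close>

lemma run_determined_by_few_points:
  fixes T :: "'x algorithm" and f :: "'x \<Rightarrow> real"
  shows "\<exists>S \<subseteq> queried T. finite S \<and> card S \<le> r \<and>
    (\<forall>g. (\<forall>x\<in>S. g x = f x) \<longrightarrow> run T g = run T f \<or> r < num_queries T g)"
proof (induction T arbitrary: r)
  case (Output v)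
  show ?case by (intro exI[of _ "{}"]) auto
next
  case (Query x k)
  show ?case
  proof (cases r)
    case 0
    then show ?thesis by (intro exI[of _ "{}"]) auto
  next
    case (Suc r')
    obtain S where S: "S \<subseteq> queried (k (f x))" "finite S" "card S \<le> r'"
      "\<And>g. (\<forall>x\<in>S. g x = f x) \<Longrightarrow> run (k (f x)) g = run (k (f x)) f \<or> r' < num_queries (k (f x)) g"
      using Query.IH[of "k (f x)" r'] by blast
    have "insert x S \<subseteq> queried (Query x k)" "finite (insert x S)"
      using S(1,2) by auto
    moreover have "card (insert x S) \<le> r"
      using S(2,3) Suc by (simp add: card_insert_if)
    moreover have "\<forall>g. (\<forall>y\<in>insert x S. g y = f y) \<longrightarrow>
        run (Query x k) g = run (Query x k) f \<or> r < num_queries (Query x k) g"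
      using S(4) Suc by simp
    ultimately show ?thesis by blast
  qed
qed

text \<open>Picking a point of \<open>S\<close> in each set that is hit is injective by
  disjointness.\<close>

lemma card_hit_le:
  assumes "finite S" "disjoint_family_on B J"
  shows "card {j\<in>J. S \<inter> B j \<noteq> {}} \<le> card S"
proof (rule card_inj_on_le)
  let ?h = "\<lambda>j. SOME x. x \<in> S \<inter> B j"
  have h: "?h j \<in> S \<inter> B j" if "S \<inter> B j \<noteq> {}" for j
    using that some_in_eq[of "S \<inter> B j"] by blast
  show "inj_on ?h {j\<in>J. S \<inter> B j \<noteq> {}}"
  proof (rule inj_onI)
    fix i j
    assume ij: "i \<in> {j\<in>J. S \<inter> B j \<noteq> {}}" "j \<in> {j\<in>J. S \<inter> B j \<noteq> {}}" and eq: "?h i = ?h j"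
    have "?h i \<in> B i" "?h i \<in> B j"
      using h[of i] h[of j] ij unfolding eq by blast+
    then show "i = j"
      using ij assms(2) unfolding disjoint_family_on_def by blast
  qed
  show "?h ` {j\<in>J. S \<inter> B j \<noteq> {}} \<subseteq> S" using h by blast
qed fact

text \<open>The sum is the expected number of events that occur.\<close>

lemma (in prob_space) sum_prob_le:
  assumes "finite J" "\<And>j. j \<in> J \<Longrightarrow> E j \<in> events"
    and "\<And>\<omega>. \<omega> \<in> space M \<Longrightarrow> card {j\<in>J. \<omega> \<in> E j} \<le> r"
  shows "(\<Sum>j\<in>J. prob (E j)) \<le> real r"
proof -
  have int: "integrable M (indicator (E j) :: 'a \<Rightarrow> real)" if "j \<in> J" for j
    using assms(2)[OF that] by (intro integrable_real_indicator) (auto simp: emeasure_eq_measure)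
  have "(\<Sum>j\<in>J. prob (E j)) = (\<Sum>j\<in>J. expectation (indicator (E j)))"
    using assms(2) by (intro sum.cong) auto
  also have "\<dots> = expectation (\<lambda>\<omega>. \<Sum>j\<in>J. indicator (E j) \<omega>)"
    by (rule Bochner_Integration.integral_sum[symmetric]) (rule int)
  also have "\<dots> \<le> expectation (\<lambda>\<omega>. real r)"
  proof (rule integral_mono)
    show "integrable M (\<lambda>\<omega>. \<Sum>j\<in>J. indicator (E j) \<omega> :: real)"
      by (rule Bochner_Integration.integrable_sum) (rule int)
    fix \<omega> assume \<omega>: "\<omega> \<in> space M"
    have "(\<Sum>j\<in>J. indicator (E j) \<omega> :: real) = real (card {j\<in>J. \<omega> \<in> E j})"
      using assms(1) by (simp add: indicator_def sum.If_cases Int_def)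
    then show "(\<Sum>j\<in>J. indicator (E j) \<omega>) \<le> real r"
      using assms(3)[OF \<omega>] by simp
  qed simp
  finally show ?thesis by (simp add: prob_space)
qed

text \<open>Accepting \<open>Y j\<close> and rejecting \<open>N j\<close> requires the path of a
  tree on the common values \<open>f\<close> to enter \<open>B j\<close>. Few queries allow this for
  few \<open>j\<close> only, yet each \<open>j\<close> needs probability \<open>1 / 3\<close>. The
  function \<open>f\<close> itself may fail to be a distribution.\<close>

lemma query_lower_bound:
  fixes Y N :: "'j \<Rightarrow> nat pmf"
  assumes tester: "monotonicity_tester n \<epsilon> P"
    and J: "finite J" "J \<noteq> {}"
    and Y: "\<And>j. j \<in> J \<Longrightarrow> Y j \<in> monotone_dists n"
    and N: "\<And>j. j \<in> J \<Longrightarrow> N j \<in> dists n" "\<And>j. j \<in> J \<Longrightarrow> dist_to_monotone n (N j) \<ge> \<epsilon>"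
    and disj: "disjoint_family_on B J"
    and agree: "\<And>j x. j \<in> J \<Longrightarrow> x \<in> {1..n} - B j \<Longrightarrow> pmf (Y j) x = f x"
      "\<And>j x. j \<in> J \<Longrightarrow> x \<in> {1..n} - B j \<Longrightarrow> pmf (N j) x = f x"
  shows "worst_case_queries_at_least n P (real (card J) / 3)"
proof (rule ccontr)
  assume neg: "\<not> ?thesis"
  have rand: "prob_space P" "\<And>T. T \<in> space P \<Longrightarrow> queried T \<subseteq> {1..n}"
    "\<And>D. D \<in> dists n \<Longrightarrow> {T \<in> space P. run T (pmf D) = ACCEPT} \<in> sets P"
    using tester by (auto simp: monotonicity_tester_def randomized_algorithm_def)
  interpret prob_space P by fact
  have Yd: "Y j \<in> dists n" if "j \<in> J" for j
    using Y[OF that] by (simp add: monotone_dists_def)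
  have K: "card J > 0" using J by (simp add: card_gt_0_iff)
  \<comment> \<open>The largest natural number strictly below \<open>card J / 3\<close>.\<close>
  define r where "r = nat (\<lceil>real (card J) / 3\<rceil> - 1)"
  have r: "real r < real (card J) / 3"
    using K unfolding r_def by linarith
  have few: "num_queries T (pmf D) \<le> r" if "T \<in> space P" "D \<in> dists n" for T D
  proof -
    have "real (num_queries T (pmf D)) < real (card J) / 3"
      using neg that by (auto simp: worst_case_queries_at_least_def not_le)
    then show ?thesis unfolding r_def by linarith
  qed
  define A where "A j = {T \<in> space P. run T (pmf (Y j)) = ACCEPT}" for j
  define R where "R j = {T \<in> space P. run T (pmf (N j)) = REJECT}" for j
  have R_eq: "R j = space P - {T \<in> space P. run T (pmf (N j)) = ACCEPT}" for j
  proof -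
    have "v = REJECT \<longleftrightarrow> v \<noteq> ACCEPT" for v by (cases v) auto
    then show ?thesis unfolding R_def by auto
  qed
  have ev: "A j \<in> events" "R j \<in> events" if "j \<in> J" for j
    using rand(3)[OF Yd[OF that]] rand(3)[OF N(1)[OF that]] unfolding A_def R_eq by auto
  have third: "1 / 3 \<le> prob (A j \<inter> R j)" if j: "j \<in> J" for j
  proof -
    have "prob (A j) \<ge> 2 / 3" "prob (R j) \<ge> 2 / 3"
      using tester Y[OF j] N[OF j] unfolding A_def R_def monotonicity_tester_def by auto
    \<comment> \<open>Inclusion-exclusion: the overlap is at least
      \<open>2 / 3 + 2 / 3 - 1\<close>.\<close>
    moreover have "prob (A j \<union> R j) = prob (A j) + prob (R j) - prob (A j \<inter> R j)"
      using ev[OF j] by (intro measure_Un3) (auto simp: fmeasurable_eq_sets)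
    ultimately show ?thesis using prob_le_1[of "A j \<union> R j"] by linarith
  qed
  have "card {j\<in>J. T \<in> A j \<inter> R j} \<le> r" if T: "T \<in> space P" for T
  proof -
    \<comment> \<open>Since \<open>f\<close> is common to all \<open>j\<close>, one set
      \<open>S\<close> serves every \<open>j\<close>.\<close>
    obtain S where S: "S \<subseteq> queried T" "finite S" "card S \<le> r"
      "\<And>g. (\<forall>x\<in>S. g x = f x) \<Longrightarrow> run T g = run T f \<or> r < num_queries T g"
      using run_determined_by_few_points[of T r f] by blast
    have "{j\<in>J. T \<in> A j \<inter> R j} \<subseteq> {j\<in>J. S \<inter> B j \<noteq> {}}"
    proof (rule subsetI, rule ccontr)
      fix j assume j: "j \<in> {j\<in>J. T \<in> A j \<inter> R j}" and "j \<notin> {j\<in>J. S \<inter> B j \<noteq> {}}"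
      then have "\<forall>x\<in>S. x \<in> {1..n} - B j" and jJ: "j \<in> J"
        using S(1) rand(2)[OF T] by blast+
      then have "\<forall>x\<in>S. pmf (Y j) x = f x" "\<forall>x\<in>S. pmf (N j) x = f x"
        using agree by blast+
      then have "run T (pmf (Y j)) = run T (pmf (N j))"
        using S(4)[of "pmf (Y j)"] S(4)[of "pmf (N j)"] few[OF T Yd[OF jJ]] few[OF T N(1)[OF jJ]]
        by (auto simp: not_less)
      then show False using j by (auto simp: A_def R_def)
    qed
    then have "card {j\<in>J. T \<in> A j \<inter> R j} \<le> card {j\<in>J. S \<inter> B j \<noteq> {}}"
      using J(1) by (intro card_mono) auto
    also have "\<dots> \<le> card S" using card_hit_le[OF S(2) disj] .
    finally show ?thesis using S(3) by linarith
  qed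
  then have "(\<Sum>j\<in>J. prob (A j \<inter> R j)) \<le> real r"
    using J(1) ev by (intro sum_prob_le) auto
  moreover have "(\<Sum>j\<in>J. 1 / 3) \<le> (\<Sum>j\<in>J. prob (A j \<inter> R j))"
    using third by (intro sum_mono)
  ultimately show False using r by simp
qed

section \<open>Distance from the monotone distributions\<close>

lemma sum_pmf_dists:
  assumes "D \<in> dists n"
  shows "(\<Sum>x\<in>{1..n}. pmf D x) = 1"
  using assms by (intro sum_pmf_eq_1) (auto simp: dists_def)

text \<open>The differences sum to 0, so an excess at \<open>x\<close> is matched by at least as
  much absolute difference elsewhere; halving the total leaves the excess.\<close>

lemma pmf_diff_le_d_TV:
  assumes "D \<in> dists n" "D' \<in> dists n" "x \<in> {1..n}"
  shows "pmf D x - pmf D' x \<le> d_TV n D D'"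
proof -
  let ?d = "\<lambda>y. pmf D y - pmf D' y"
  have "?d x + sum ?d ({1..n} - {x}) = 0"
    using sum_pmf_dists[OF assms(1)] sum_pmf_dists[OF assms(2)]
      sum.remove[OF finite_atLeastAtMost assms(3), of ?d]
    by (simp add: sum_subtractf)
  moreover have "\<bar>sum ?d ({1..n} - {x})\<bar> \<le> (\<Sum>y\<in>{1..n} - {x}. \<bar>?d y\<bar>)"
    by (rule sum_abs)
  moreover have "2 * d_TV n D D' = \<bar>?d x\<bar> + (\<Sum>y\<in>{1..n} - {x}. \<bar>?d y\<bar>)"
    using sum.remove[OF finite_atLeastAtMost assms(3), of "\<lambda>y. \<bar>?d y\<bar>"] by (simp add: d_TV_def)
  ultimately show ?thesis by linarith
qed

lemma pmf_monotone_le: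
  assumes "D \<in> monotone_dists n" "x \<in> {1..n}"
  shows "pmf D x \<le> 1 / real x"
proof -
  have D: "D \<in> dists n" "\<And>i. i \<in> {1..x} \<Longrightarrow> pmf D x \<le> pmf D i"
    using assms by (auto simp: monotone_dists_def)
  have "real x * pmf D x = (\<Sum>i\<in>{1..x}. pmf D x)" by simp
  also have "\<dots> \<le> (\<Sum>i\<in>{1..x}. pmf D i)" using D(2) by (rule sum_mono)
  also have "\<dots> \<le> (\<Sum>i\<in>{1..n}. pmf D i)" using assms(2) by (intro sum_mono2) auto
  also have "\<dots> = 1" using sum_pmf_dists[OF D(1)] .
  finally show ?thesis using assms(2) by (simp add: field_simps)
qed

lemma return_pmf_1_monotone:
  assumes "n \<ge> 1"
  shows "return_pmf 1 \<in> monotone_dists n"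
  using assms by (auto simp: monotone_dists_def dists_def indicator_def)

text \<open>A single heavy point far to the right certifies distance, as a monotone distribution has
  mass at most \<open>1 / x\<close> there.\<close>

lemma dist_to_monotone_ge:
  assumes "D \<in> dists n" "x \<in> {1..n}"
  shows "pmf D x - 1 / real x \<le> dist_to_monotone n D"
  unfolding dist_to_monotone_def
proof (rule cINF_greatest)
  show "monotone_dists n \<noteq> {}" using return_pmf_1_monotone[of n] assms(2) by auto
  fix D' assume D': "D' \<in> monotone_dists n"
  then have "D' \<in> dists n" by (simp add: monotone_dists_def)
  then show "pmf D x - 1 / real x \<le> d_TV n D D'"
    using pmf_diff_le_d_TV[OF assms(1) _ assms(2)] pmf_monotone_le[OF D' assms(2)] by fastforce
qed

section \<open>Blocks of geometrically growing size\<close>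

text \<open>Total size of the blocks before block \<open>i\<close>; the last point of block
  \<open>i\<close> is therefore \<open>block_end m (Suc i)\<close>. The exponent starts at 1, so
  that already block 0 ends at \<open>m\<close>.\<close>

definition block_end :: "nat \<Rightarrow> nat \<Rightarrow> nat" where
  "block_end m i = (\<Sum>l<i. m ^ Suc l)"

definition block :: "nat \<Rightarrow> nat \<Rightarrow> nat set" where
  "block m i = {block_end m i<..block_end m (Suc i)}"

lemma block_end_mono: "i \<le> j \<Longrightarrow> block_end m i \<le> block_end m j"
  unfolding block_end_def by (intro sum_mono2) auto

text \<open>For ratio at least 2, the next power dominates a geometric sum.\<close>

lemma block_end_le_power: "m \<ge> 2 \<Longrightarrow> block_end m k \<le> m ^ Suc k"
proof (induction k)
  case (Suc k)
  have "block_end m (Suc k) = block_end m k + m ^ Suc k" by (simp add: block_end_def)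
  also have "\<dots> \<le> 2 * m ^ Suc k" using Suc by simp
  also have "\<dots> \<le> m * m ^ Suc k" using Suc.prems by (intro mult_right_mono) auto
  finally show ?case by simp
qed (simp add: block_end_def)

lemma finite_block [simp]: "finite (block m i)"
  by (simp add: block_def)

lemma card_block [simp]: "card (block m i) = m ^ Suc i"
  by (simp add: block_def block_end_def)

lemma last_in_block: "m > 0 \<Longrightarrow> block_end m (Suc i) \<in> block m i"
  by (simp add: block_def block_end_def)

lemma block_nonempty: "m > 0 \<Longrightarrow> block m i \<noteq> {}"
  using last_in_block by blast

lemma block_subset: "i < k \<Longrightarrow> block m i \<subseteq> {1..block_end m k}"
  using block_end_mono[of "Suc i" k m] by (auto simp: block_def)

lemma block_index_mono:
  assumes "x \<in> block m i" "y \<in> block m j" "x \<le> y"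
  shows "i \<le> j"
proof (rule ccontr)
  assume "\<not> i \<le> j"
  then show False
    using assms block_end_mono[of "Suc j" i m] by (auto simp: block_def)
qed

lemma disjoint_blocks: "disjoint_family_on (block m) J"
  unfolding disjoint_family_on_def
proof (intro ballI impI)
  fix i j :: nat assume "i \<noteq> j"
  then show "block m i \<inter> block m j = {}"
    using block_index_mono[of _ m i _ j] block_index_mono[of _ m j _ i] by (meson disjoint_iff order.antisym order_refl)
qed

lemma blocks_cover: "1 \<le> x \<Longrightarrow> x \<le> block_end m k \<Longrightarrow> \<exists>i<k. x \<in> block m i"
proof (induction k)
  case (Suc k)
  show ?case
  proof (cases "x \<le> block_end m k")
    case True
    then show ?thesis using Suc less_Suc_eq by blast
  next
    case False
    then show ?thesis using Suc.prems by (auto simp: block_def)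
  qed
qed (simp add: block_end_def)

section \<open>The hard pairs of distributions\<close>

definition background :: "nat \<Rightarrow> nat \<Rightarrow> nat pmf" where
  "background m k = bind_pmf (pmf_of_set {..<k}) (\<lambda>i. pmf_of_set (block m i))"

lemma pmf_background:
  assumes "k > 0" "m > 0"
  shows "pmf (background m k) x = (\<Sum>i<k. indicator (block m i) x / real m ^ Suc i) / real k"
proof -
  have "{..<k} \<noteq> {}" using assms(1) by auto
  then show ?thesis
    using assms(2) by (simp add: background_def pmf_bind_pmf_of_set block_nonempty)
qed

lemma pmf_background_block:
  assumes "k > 0" "m > 0" "i < k" "x \<in> block m i"
  shows "pmf (background m k) x = 1 / (real k * real m ^ Suc i)"
proof -
  have *: "indicator (block m l) x = (if l = i then 1 else 0 :: real)" for l
    using assms(4) disjoint_blocks[of m UNIV] by (auto simp: disjoint_family_on_def indicator_def)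
  show ?thesis using assms by (simp add: pmf_background * if_distrib if_distribR cong: if_cong)
qed

lemma set_background:
  assumes "k > 0" "m > 0"
  shows "set_pmf (background m k) \<subseteq> {1..block_end m k}"
proof -
  have "{..<k} \<noteq> {}" using assms(1) by auto
  then have "set_pmf (background m k) = (\<Union>i\<in>{..<k}. block m i)"
    using assms(2) by (simp add: background_def block_nonempty)
  then show ?thesis using block_subset[of _ k m] by auto
qed

text \<open>The coin shows \<open>True\<close> with probability \<open>1 / 4\<close>, so
  \<open>E\<close> receives weight \<open>3 / 4\<close>.\<close>

definition hide :: "nat \<Rightarrow> nat \<Rightarrow> nat pmf \<Rightarrow> nat pmf" where
  "hide m k E = bind_pmf (bernoulli_pmf (1 / 4)) (\<lambda>b. if b then background m k else E)"

lemma pmf_hide: "pmf (hide m k E) x = pmf (background m k) x / 4 + 3 / 4 * pmf E x"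
  by (simp add: hide_def pmf_bind)

lemma hide_in_dists:
  assumes "k > 0" "m > 0" "block_end m k \<le> n" "set_pmf E \<subseteq> {1..n}"
  shows "hide m k E \<in> dists n"
proof -
  have "set_pmf (hide m k E) \<subseteq> set_pmf (background m k) \<union> set_pmf E"
    by (auto simp: hide_def split: if_splits)
  also have "\<dots> \<subseteq> {1..n}"
    using set_background[OF assms(1,2)] assms(3,4) by auto
  finally show ?thesis by (simp add: dists_def)
qed

text \<open>With \<open>m = 4 * k\<close>, an ordinary block has total mass \<open>1 / m\<close> and
  block \<open>j\<close> has \<open>1 / m + 3 / 4\<close>, at most 1. The extra weight thus raises
  the density by a factor of at most \<open>m\<close>, which is the growth of the block
  sizes.\<close>

lemma hide_block_monotone:
  assumes k: "k > 0" and j: "j < k" and n: "block_end (4 * k) k \<le> n"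
  shows "hide (4 * k) k (pmf_of_set (block (4 * k) j)) \<in> monotone_dists n"
proof -
  define m where "m = 4 * k"
  have m: "m > 0" "real m \<ge> 4" "real m = 4 * real k" using k by (auto simp: m_def)
  let ?D = "hide m k (pmf_of_set (block m j))"
  have blk: "pmf ?D x = (1 / real m + (if i = j then 3 / 4 else 0)) / real m ^ Suc i"
    if "i < k" "x \<in> block m i" for i x
  proof -
    have "x \<in> block m j \<longleftrightarrow> i = j"
      using that disjoint_blocks[of m UNIV] by (auto simp: disjoint_family_on_def)
    then show ?thesis
      using that k m(1) by (auto simp: pmf_hide pmf_background_block block_nonempty pmf_of_set
        indicator_def m(3) field_simps)
  qed
  have dists: "?D \<in> dists n"
    using n k m(1) block_subset[OF j, of m] by (intro hide_in_dists) (auto simp: m_def[symmetric] block_nonempty)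
  have "pmf ?D y \<le> pmf ?D x" if xy: "x \<in> {1..n}" "x \<le> y" for x y
  proof (cases "y \<le> block_end m k")
    \<comment> \<open>To the right of all blocks there is no mass.\<close>
    case False
    then have "y \<notin> block m i" if "i < k" for i using block_subset[OF that, of m] by auto
    then have "pmf ?D y = 0"
      using j k m(1) by (simp add: pmf_hide pmf_background block_nonempty pmf_of_set)
    then show ?thesis by simp
  next
    case True
    then obtain i i' where i: "i < k" "x \<in> block m i" and i': "i' < k" "y \<in> block m i'"
      using blocks_cover[of x m k] blocks_cover[of y m k] xy by fastforce
    show ?thesis
    proof (cases "i = i'")
      case True
      then show ?thesis using blk[OF i] blk[OF i'] by simp
    next
      case False
      then have less: "Suc i \<le> i'" using block_index_mono[OF i(2) i'(2) xy(2)] by simp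
      have "1 / real m \<le> 1 / 4" using m(2) by (simp add: field_simps)
      then have "pmf ?D y \<le> 1 / real m ^ Suc i'"
        unfolding blk[OF i'] by (intro divide_right_mono) auto
      also have "\<dots> \<le> 1 / real m ^ Suc (Suc i)"
        using less m by (intro divide_left_mono power_increasing) auto
      also have "\<dots> = (1 / real m) / real m ^ Suc i" by simp
      also have "\<dots> \<le> pmf ?D x"
        using m unfolding blk[OF i] by (intro divide_right_mono) auto
      finally show ?thesis .
    qed
  qed
  with dists show ?thesis unfolding monotone_dists_def m_def by auto
qed

text \<open>The end of block \<open>j\<close> carries mass at least \<open>3 / 4\<close>, while a
  monotone distribution has at most \<open>1 / 4\<close> there.\<close>

lemma hide_last_far:
  assumes k: "k > 0" and j: "j < k" and n: "block_end (4 * k) k \<le> n"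
  shows "hide (4 * k) k (return_pmf (block_end (4 * k) (Suc j))) \<in> dists n"
    and "1 / 2 \<le> dist_to_monotone n (hide (4 * k) k (return_pmf (block_end (4 * k) (Suc j))))"
proof -
  let ?x = "block_end (4 * k) (Suc j)"
  let ?D = "hide (4 * k) k (return_pmf ?x)"
  have x: "?x \<in> {1..n}"
    using last_in_block[of "4 * k" j] block_subset[OF j, of "4 * k"] k n by auto
  then show D: "?D \<in> dists n" using k n by (intro hide_in_dists) auto
  \<comment> \<open>Even the first block ends at \<open>4 * k\<close>, which is at least 4.\<close>
  have "4 * k = block_end (4 * k) (Suc 0)" by (simp add: block_end_def)
  also have "\<dots> \<le> ?x" by (intro block_end_mono) simp
  finally have "1 / real ?x \<le> 1 / 4" using k by (intro divide_left_mono) auto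
  moreover have "pmf ?D ?x \<ge> 3 / 4" by (simp add: pmf_hide)
  ultimately show "1 / 2 \<le> dist_to_monotone n ?D"
    using dist_to_monotone_ge[OF D x] by linarith
qed

section \<open>The lower bound in terms of \<open>n\<close>\<close>

lemma block_query_lower_bound:
  assumes k: "k > 0" and n: "(4 * k) ^ Suc k \<le> n"
    and tester: "monotonicity_tester n (1 / 2) P"
  shows "worst_case_queries_at_least n P (real k / 3)"
proof -
  let ?m = "4 * k"
  have n': "block_end ?m k \<le> n" using block_end_le_power[of ?m k] k n by linarith
  have "worst_case_queries_at_least n P (real (card {..<k}) / 3)"
  proof (rule query_lower_bound[OF tester])
    fix j assume "j \<in> {..<k}"
    then have j: "j < k" by simp
    show "hide ?m k (pmf_of_set (block ?m j)) \<in> monotone_dists n"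
      using hide_block_monotone[OF k j n'] .
    show "hide ?m k (return_pmf (block_end ?m (Suc j))) \<in> dists n"
      "1 / 2 \<le> dist_to_monotone n (hide ?m k (return_pmf (block_end ?m (Suc j))))"
      using hide_last_far[OF k j n'] by auto
    fix x assume x: "x \<in> {1..n} - block ?m j"
    show "pmf (hide ?m k (pmf_of_set (block ?m j))) x = pmf (background ?m k) x / 4"
      using x k by (simp add: pmf_hide block_nonempty pmf_of_set)
    show "pmf (hide ?m k (return_pmf (block_end ?m (Suc j)))) x = pmf (background ?m k) x / 4"
      using x k last_in_block[of ?m j] by (auto simp: pmf_hide indicator_def)
  qed (use k disjoint_blocks in auto)
  then show ?thesis by simp
qed

lemma worst_case_queries_at_least_mono:
  "worst_case_queries_at_least n P r \<Longrightarrow> s \<le> r \<Longrightarrow> worst_case_queries_at_least n P s"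
  unfolding worst_case_queries_at_least_def by (meson order_trans)

lemma one_query_needed:
  assumes n: "n \<ge> 3" and tester: "monotonicity_tester n (1 / 2) P"
  shows "worst_case_queries_at_least n P 1"
proof -
  have D: "return_pmf 3 \<in> dists n" using n by (auto simp: dists_def)
  have "worst_case_queries_at_least n P (real (card {()}) / 3)"
  proof (rule query_lower_bound[OF tester, where Y = "\<lambda>_. return_pmf 1" and N = "\<lambda>_. return_pmf 3"
        and B = "\<lambda>_. {1..n}"])
    \<comment> \<open>The distance is at least \<open>1 - 1 / 3\<close>.\<close>
    show "1 / 2 \<le> dist_to_monotone n (return_pmf 3)"
      using dist_to_monotone_ge[OF D, of 3] n by simp
  qed (use n D return_pmf_1_monotone in \<open>auto simp: disjoint_family_on_def\<close>)
  then obtain T D where TD: "T \<in> space P" "D \<in> dists n" "real (num_queries T (pmf D)) \<ge> 1 / 3"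
    by (auto simp: worst_case_queries_at_least_def)
  \<comment> \<open>A natural number that is at least \<open>1 / 3\<close> is at least 1.\<close>
  then have "num_queries T (pmf D) > 0" by (cases "num_queries T (pmf D)") auto
  then show ?thesis using TD unfolding worst_case_queries_at_least_def
    by (intro bexI[of _ T] bexI[of _ D]) auto
qed

text \<open>Take \<open>k\<close> as the integer part of \<open>y / (4 * ln y)\<close>. Then
  \<open>4 * k\<close> is at most \<open>y\<close>, and
  \<open>y ^ Suc k = exp (Suc k * ln y)\<close> is at most \<open>exp y = n\<close>.\<close>

lemma block_count_exists:
  fixes n :: nat
  defines "y \<equiv> ln (real n)"
  assumes y: "1 \<le> ln y" "4 * ln y \<le> y" and n: "n \<ge> 3"
  obtains k where "k > 0" "(4 * k) ^ Suc k \<le> n" "y / (8 * ln y) \<le> real k"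
proof
  define k where "k = nat \<lfloor>y / (4 * ln y)\<rfloor>"
  have q: "1 \<le> y / (4 * ln y)" using y by (simp add: field_simps)
  then have fl: "real k \<le> y / (4 * ln y)" "y / (4 * ln y) < real k + 1"
    unfolding k_def by linarith+
  show k: "k > 0" using q unfolding k_def by linarith
  \<comment> \<open>Rounding down a number that is at least 1 loses at most half of it.\<close>
  show "y / (8 * ln y) \<le> real k"
  proof -
    have "y / (8 * ln y) = y / (4 * ln y) / 2" by simp
    then show ?thesis using fl k by linarith
  qed
  have yp: "y > 0" using y by linarith
  have kly: "4 * real k * ln y \<le> y" using fl(1) y by (simp add: field_simps)
  have "4 * real k * 1 \<le> 4 * real k * ln y" using y by (intro mult_left_mono) auto
  then have "4 * real k \<le> y" using kly by linarith
  then have "real ((4 * k) ^ Suc k) \<le> y ^ Suc k"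
    by (simp only: of_nat_power of_nat_mult of_nat_numeral) (intro power_mono, auto)
  also have "\<dots> = exp (real (Suc k) * ln y)"
    using yp by (simp only: exp_of_nat_mult exp_ln)
  also have "\<dots> \<le> exp y"
  proof -
    \<comment> \<open>For positive \<open>k\<close>, \<open>Suc k\<close> is at most
      \<open>4 * k\<close>.\<close>
    have "real (Suc k) * ln y \<le> (4 * real k) * ln y"
      using y k by (intro mult_right_mono) auto
    then show ?thesis using kly by simp
  qed
  also have "\<dots> = real n" using n by (simp add: y_def)
  finally show "(4 * k) ^ Suc k \<le> n" by (simp only: of_nat_le_iff)
qed

lemma half_tester_query_lower_bound:
  "\<exists>c>0. \<forall>n\<ge>3. \<forall>P. monotonicity_tester n (1 / 2) P \<longrightarrow>
      worst_case_queries_at_least n P (c * (ln (real n) / ln (ln (real n))))"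
proof -
  define a where "a = ln (ln (3 :: real))"
  have ln3: "ln (3 :: real) > 1"
    using exp_less_cancel_iff[of 1 "ln (3 :: real)"] e_less_272 by simp
  then have a: "a > 0" by (simp add: a_def)
  \<comment> \<open>\<open>1 / 24\<close> combines the \<open>1 / 8\<close> lost in choosing
    \<open>k\<close> with the \<open>1 / 3\<close> of the query bound; \<open>a / 3\<close> handles
    \<open>ln y < 1\<close>, where \<open>y < 3\<close> and \<open>ln y\<close> is at least
    \<open>a\<close>.\<close>
  define c where "c = min (1 / 24) (a / 3)"
  have c: "c > 0" "c \<le> 1 / 24" "c \<le> a / 3" using a by (auto simp: c_def)
  have "worst_case_queries_at_least n P (c * (ln (real n) / ln (ln (real n))))"
    if n: "n \<ge> 3" and tester: "monotonicity_tester n (1 / 2) P" for n P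
  proof -
    define y where "y = ln (real n)"
    have y3: "ln 3 \<le> y" using n by (simp add: y_def)
    then have lny: "a \<le> ln y" using ln3 by (simp add: a_def)
    have y0: "y > 0" using y3 ln3 by linarith
    \<comment> \<open>Blocks are used in the first case; in the other two the claimed bound is at
      most 1, so one query suffices.\<close>
    consider "1 \<le> ln y" "4 * ln y \<le> y" | "ln y < 1" | "y < 4 * ln y" by linarith
    then have "worst_case_queries_at_least n P (c * (y / ln y))"
    proof cases
      case 1
      then obtain k where k: "k > 0" "(4 * k) ^ Suc k \<le> n" "y / (8 * ln y) \<le> real k"
        using block_count_exists[of n] n unfolding y_def by metis
      have "c * (y / ln y) \<le> 1 / 24 * (y / ln y)"
        using c y0 less_le_trans[OF a lny] by (intro mult_right_mono divide_nonneg_pos) linarith+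
      also have "\<dots> = y / (8 * ln y) / 3" by simp
      also have "\<dots> \<le> real k / 3" using k(3) by simp
      finally show ?thesis
        using block_query_lower_bound[OF k(1,2) tester] worst_case_queries_at_least_mono by blast
    next
      case 2
      then have "y < exp 1" using y0 by (metis exp_less_cancel_iff exp_ln)
      then have "y < 3" using e_less_272 by linarith
      have "c * (y / ln y) \<le> (a / 3) * (3 / a)"
        using \<open>y < 3\<close> c y0 lny a less_le_trans[OF a lny]
        by (intro mult_mono frac_le divide_nonneg_pos) linarith+
      also have "\<dots> = 1" using a by simp
      finally show ?thesis
        using one_query_needed[OF n tester] worst_case_queries_at_least_mono by blast
    next
      case 3
      then have "y / ln y \<le> 4" using lny a by (simp add: field_simps)
      then have "c * (y / ln y) \<le> 1 / 24 * 4"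
        using c y0 less_le_trans[OF a lny] by (intro mult_mono divide_nonneg_pos) linarith+
      then have "c * (y / ln y) \<le> 1" by linarith
      then show ?thesis
        using one_query_needed[OF n tester] worst_case_queries_at_least_mono by blast
    qed
    then show ?thesis by (simp add: y_def)
  qed
  with c(1) show ?thesis by blast
qed

theorem theorem5p6:
  "(\<exists>\<epsilon>\<^sub>0>0. \<exists>c>0. \<forall>n\<ge>3. \<forall>P. monotonicity_tester n \<epsilon>\<^sub>0 P \<longrightarrow>
      worst_case_queries_at_least n P (c * (ln (real n) / ln (ln (real n))))) \<and>
   (\<exists>c>0. \<forall>n\<ge>3. \<forall>P. monotonicity_tester n (1 / 2) P \<longrightarrow>
      worst_case_queries_at_least n P (c * (ln (real n) / ln (ln (real n)))))"
proof (rule conjI)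
  show "\<exists>\<epsilon>\<^sub>0>0. \<exists>c>0. \<forall>n\<ge>3. \<forall>P. monotonicity_tester n \<epsilon>\<^sub>0 P \<longrightarrow>
      worst_case_queries_at_least n P (c * (ln (real n) / ln (ln (real n))))"
    \<comment> \<open>The second conjunct supplies the first, with \<open>1 / 2\<close> as the
      witness.\<close>
    by (rule exI[of _ "1 / 2"], rule conjI[OF _ half_tester_query_lower_bound]) simp
qed (fact half_tester_query_lower_bound)

end
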